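(* Let $a,b$ be distinct token names, and for each of the thirteen Allen relations $R$ let $\mathcal C_R(a,b)$ be the endpoint encoding of "$a\ R\ b$" given in the context. (1) If $a$ is the trigger token and $b$ is a non-trigger token, i.e. for the rule $a[x=v]\Rightarrow\exists b[y=w].\,\mathcal C_R(a,b)$ (where $x,y$ are state variables and $v\in V_x$, $w\in V_y$), the rule is eager if and only if $R$ is one of: before, after, meets, met-by, starts, started-by, contains, equals. (Equivalently, it is not eager exactly for $R$ among ends, ended-by, overlaps, overlapped-by, during.) (2) If neither $a$ nor $b$ is a trigger token, i.e. for the rule $\top\Rightarrow\exists a[x=v]\,b[y=w].\,\mathcal C_R(a,b)$, the rule is eager if and only if $R$ is one of: before, after, meets, met-by.
   Context: Each state variable $x$ has a finite domain $V_x$. Terms are $\mathrm{start}(a)$ and $\mathrm{end}(a)$ for token names $a$. Atoms are $t_1\le t_2$ and $t_1<t_2$ for terms $t_1,t_2$; $t_1=t_2$ abbreviates the two atoms $t_1\le t_2$ and $t_2\le t_1$. A clause $\mathcal C$ is a finite conjunction of atoms, identified with the finite set of its atoms. A synchronization rule is $a_0[x_0=v_0]\Rightarrow\mathcal E_1\lor\dots\lor\mathcal E_k$ ($a_0$ is then the trigger token) or $\top\Rightarrow\mathcal E_1\lor\dots\lor\mathcal E_k$ (triggerless), where each existential statement $\mathcal E_j$ has the form $\exists a_1[x_1=v_1]\cdots a_n[x_n=v_n].\,\mathcal C$ with $\mathcal C$ a clause over $a_1,\dots,a_n$ and possibly $a_0$. **Closure.** $\hat{\mathcal C}$ is the smallest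 set of atoms containing $\mathcal C$ such that: (i) $t\le t\in\hat{\mathcal C}$ for every term $t$ occurring in $\mathcal C$; (ii) if $\mathrm{start}(a)$ and $\mathrm{end}(a)$ both occur in $\mathcal C$ then $\mathrm{start}(a)<\mathrm{end}(a)\in\hat{\mathcal C}$; (iii) $t_1<t_2\in\hat{\mathcal C}$ implies $t_1\le t_2\in\hat{\mathcal C}$; (iv) $t_1\le t_2,\ t_2\le t_3\in\hat{\mathcal C}$ imply $t_1\le t_3\in\hat{\mathcal C}$; (v) $t_1<t_2,\ t_2\le t_3\in\hat{\mathcal C}$ imply $t_1<t_3\in\hat{\mathcal C}$; (vi) $t_1\le t_2,\ t_2<t_3\in\hat{\mathcal C}$ imply $t_1<t_3\in\hat{\mathcal C}$. **Eager.** A rule is eager if for every clause $\mathcal C$ of its existential statements and all distinct token names $a_1,a_2$ appearing in $\mathcal C$: 1. if $a_1,a_2$ are both non-trigger and $\mathrm{start}(a_2)\le\mathrm{end}(a_1),\ \mathrm{end}(a_1)\le\mathrm{end}(a_2)\in\hat{\mathcal C}$, then $\mathrm{end}(a_1)\le\mathrm{start}(a_2)\in\hat{\mathcal C}$; 2. if $a_1$ is trigger or non-trigger, $a_2$ is non-trigger, and $\mathrm{start}(a_2)\le\mathrm{start}(a_1),\ \mathrm{start}(a_1)\le\mathrm{end}(a_2)\in\hat{\mathcal C}$, then $\mathrm{start}(a_1)\le\mathrm{start}(a_2)\in\hat{\mathcal C}$; 3. if $a_1$ is the trigger token, $a_2$ is non-trigger, and $\mathrm{start}(a_1)\le\mathrm{start}(a_2),\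 \mathrm{end}(a_1)\le\mathrm{end}(a_2)\in\hat{\mathcal C}$, then $\mathrm{start}(a_2)\le\mathrm{start}(a_1)\in\hat{\mathcal C}$. **Encodings $\mathcal C_R(a,b)$ of "$a\ R\ b$".** - before: $\mathrm{end}(a)<\mathrm{start}(b)$. - meets: $\mathrm{end}(a)=\mathrm{start}(b)$. - ends: $\mathrm{start}(b)<\mathrm{start}(a)\land\mathrm{end}(a)=\mathrm{end}(b)$. - starts: $\mathrm{start}(a)=\mathrm{start}(b)\land\mathrm{end}(a)<\mathrm{end}(b)$. - overlaps: $\mathrm{start}(a)<\mathrm{start}(b)\land\mathrm{start}(b)<\mathrm{end}(a)\land\mathrm{end}(a)<\mathrm{end}(b)$. - during: $\mathrm{start}(b)<\mathrm{start}(a)\land\mathrm{end}(a)<\mathrm{end}(b)$. - equals: $\mathrm{start}(a)=\mathrm{start}(b)\land\mathrm{end}(a)=\mathrm{end}(b)$. - The inverse relations after, met-by, ended-by, started-by, overlapped-by, contains are the inverses of before, meets, ends, starts, overlaps, during respectively: $\mathcal C_{R^{-1}}(a,b)=\mathcal C_R(b,a)$. *)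

theory Defs
  imports Main
begin

text \<open>Type variables: \<open>'n\<close> for token names, \<open>'x\<close> for state variables, \<open>'v\<close> for values.
  The domain of a state variable \<open>x\<close> is \<open>V x\<close> for a function \<open>V\<close> of type \<open>'x \<Rightarrow> 'v set\<close>.\<close>

datatype 'n tm = Start (token: 'n) | End (token: 'n)

datatype 'n atom =
    Le "'n tm" "'n tm"  (infix "\<preceq>" 50)
  | Lt "'n tm" "'n tm"  (infix "\<prec>" 50)

type_synonym 'n clause = "'n atom set"

definition Eq :: "'n tm \<Rightarrow> 'n tm \<Rightarrow> 'n clause"  (infix "\<doteq>" 50)
  where "(t \<doteq> u) = {t \<preceq> u, u \<preceq> t}"

fun atom_terms :: "'n atom \<Rightarrow> 'n tm set" where
  "atom_terms (t \<preceq> u) = {t, u}"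
| "atom_terms (t \<prec> u) = {t, u}"

definition clause_terms :: "'n clause \<Rightarrow> 'n tm set"
  where "clause_terms C = (\<Union>\<alpha>\<in>C. atom_terms \<alpha>)"

definition clause_tokens :: "'n clause \<Rightarrow> 'n set"
  where "clause_tokens C = token ` clause_terms C"

inductive_set atom_closure :: "'n clause \<Rightarrow> 'n atom set" for C :: "'n clause" where
  base: "\<alpha> \<in> C \<Longrightarrow> \<alpha> \<in> atom_closure C"
| refl: "t \<in> clause_terms C \<Longrightarrow> (t \<preceq> t) \<in> atom_closure C"
| start_end: "Start a \<in> clause_terms C \<Longrightarrow> End a \<in> clause_terms C \<Longrightarrow>
    (Start a \<prec> End a) \<in> atom_closure C"
| less_imp_le: "(t\<^sub>1 \<prec> t\<^sub>2) \<in> atom_closure C \<Longrightarrow> (t\<^sub>1 \<preceq> t\<^sub>2) \<in> atom_closure C"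
| le_le_trans: "(t\<^sub>1 \<preceq> t\<^sub>2) \<in> atom_closure C \<Longrightarrow> (t\<^sub>2 \<preceq> t\<^sub>3) \<in> atom_closure C \<Longrightarrow> (t\<^sub>1 \<preceq> t\<^sub>3) \<in> atom_closure C"
| less_le_trans: "(t\<^sub>1 \<prec> t\<^sub>2) \<in> atom_closure C \<Longrightarrow> (t\<^sub>2 \<preceq> t\<^sub>3) \<in> atom_closure C \<Longrightarrow> (t\<^sub>1 \<prec> t\<^sub>3) \<in> atom_closure C"
| le_less_trans: "(t\<^sub>1 \<preceq> t\<^sub>2) \<in> atom_closure C \<Longrightarrow> (t\<^sub>2 \<prec> t\<^sub>3) \<in> atom_closure C \<Longrightarrow> (t\<^sub>1 \<prec> t\<^sub>3) \<in> atom_closure C"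

text \<open>A triple \<open>(a, x, v)\<close> stands for the quantifier body \<open>a[x = v]\<close>.\<close>

type_synonym ('n, 'x, 'v) quantified = "'n \<times> 'x \<times> 'v"

datatype ('n, 'x, 'v) existential =
  Exists (quants: "('n, 'x, 'v) quantified list") (clause: "'n clause")

datatype ('n, 'x, 'v) rule =
    Triggered "('n, 'x, 'v) quantified" (body: "('n, 'x, 'v) existential list")
  | Triggerless (body: "('n, 'x, 'v) existential list")

fun trigger_tokens :: "('n, 'x, 'v) rule \<Rightarrow> 'n set" where
  "trigger_tokens (Triggered (a, x, v) Es) = {a}"
| "trigger_tokens (Triggerless Es) = {}"

text \<open>The types above admit ill-scoped rules and values outside the domains;
  \<open>sync_rule\<close> singles out the synchronization rules proper.\<close>

fun wf_quantified :: "('x \<Rightarrow> 'v set) \<Rightarrow> ('n, 'x, 'v) quantified \<Rightarrow> bool" where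
  "wf_quantified V (a, x, v) \<longleftrightarrow> v \<in> V x"

fun wf_existential ::
  "('x \<Rightarrow> 'v set) \<Rightarrow> 'n set \<Rightarrow> ('n, 'x, 'v) existential \<Rightarrow> bool" where
  "wf_existential V T (Exists qs C) \<longleftrightarrow>
     (\<forall>q\<in>set qs. wf_quantified V q) \<and>
     distinct (map fst qs) \<and> fst ` set qs \<inter> T = {} \<and>
     finite C \<and> clause_tokens C \<subseteq> fst ` set qs \<union> T"

fun sync_rule :: "('x \<Rightarrow> 'v set) \<Rightarrow> ('n, 'x, 'v) rule \<Rightarrow> bool" where
  "sync_rule V (Triggered q Es) \<longleftrightarrow>
     wf_quantified V q \<and> Es \<noteq> [] \<and> (\<forall>E\<in>set Es. wf_existential V {fst q} E)"
| "sync_rule V (Triggerless Es) \<longleftrightarrow>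
     Es \<noteq> [] \<and> (\<forall>E\<in>set Es. wf_existential V {} E)"

text \<open>Eagerness of a clause, relative to the set \<open>T\<close> of trigger tokens (empty or a singleton).\<close>

definition eager_clause :: "'n set \<Rightarrow> 'n clause \<Rightarrow> bool" where
  "eager_clause T C \<longleftrightarrow>
    (\<forall>a\<^sub>1\<in>clause_tokens C. \<forall>a\<^sub>2\<in>clause_tokens C. a\<^sub>1 \<noteq> a\<^sub>2 \<longrightarrow>
      (a\<^sub>1 \<notin> T \<and> a\<^sub>2 \<notin> T \<and>
         (Start a\<^sub>2 \<preceq> End a\<^sub>1) \<in> atom_closure C \<and> (End a\<^sub>1 \<preceq> End a\<^sub>2) \<in> atom_closure C \<longrightarrow>
         (End a\<^sub>1 \<preceq> Start a\<^sub>2) \<in> atom_closure C) \<and>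
      (a\<^sub>2 \<notin> T \<and>
         (Start a\<^sub>2 \<preceq> Start a\<^sub>1) \<in> atom_closure C \<and> (Start a\<^sub>1 \<preceq> End a\<^sub>2) \<in> atom_closure C \<longrightarrow>
         (Start a\<^sub>1 \<preceq> Start a\<^sub>2) \<in> atom_closure C) \<and>
      (a\<^sub>1 \<in> T \<and> a\<^sub>2 \<notin> T \<and>
         (Start a\<^sub>1 \<preceq> Start a\<^sub>2) \<in> atom_closure C \<and> (End a\<^sub>1 \<preceq> End a\<^sub>2) \<in> atom_closure C \<longrightarrow>
         (Start a\<^sub>2 \<preceq> Start a\<^sub>1) \<in> atom_closure C))"

definition eager :: "('n, 'x, 'v) rule \<Rightarrow> bool" where
  "eager r \<longleftrightarrow> (\<forall>E\<in>set (body r). eager_clause (trigger_tokens r) (clause E))"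

datatype allen =
    Before | Meets | Ends | Starts | Overlaps | During | Equals
  | After | MetBy | EndedBy | StartedBy | OverlappedBy | Contains

function allen_clause :: "allen \<Rightarrow> 'n \<Rightarrow> 'n \<Rightarrow> 'n clause" where
  "allen_clause Before a b = {End a \<prec> Start b}"
| "allen_clause Meets a b = (End a \<doteq> Start b)"
| "allen_clause Ends a b = {Start b \<prec> Start a} \<union> (End a \<doteq> End b)"
| "allen_clause Starts a b = (Start a \<doteq> Start b) \<union> {End a \<prec> End b}"
| "allen_clause Overlaps a b = {Start a \<prec> Start b, Start b \<prec> End a, End a \<prec> End b}"
| "allen_clause During a b = {Start b \<prec> Start a, End a \<prec> End b}"
| "allen_clause Equals a b = (Start a \<doteq> Start b) \<union> (End a \<doteq> End b)"
| "allen_clause After a b = allen_clause Before b a"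
| "allen_clause MetBy a b = allen_clause Meets b a"
| "allen_clause EndedBy a b = allen_clause Ends b a"
| "allen_clause StartedBy a b = allen_clause Starts b a"
| "allen_clause OverlappedBy a b = allen_clause Overlaps b a"
| "allen_clause Contains a b = allen_clause During b a"
  by pat_completeness auto
termination
  by (relation "measure (\<lambda>(R, _).
        if R \<in> {After, MetBy, EndedBy, StartedBy, OverlappedBy, Contains} then 1 else 0)") auto

lemma sync_rule_allen:
  assumes "a \<noteq> b" and "v \<in> V x" and "w \<in> V y"
  shows "sync_rule V (Triggered (a, x, v) [Exists [(b, y, w)] (allen_clause R a b)])"
    and "sync_rule V (Triggerless [Exists [(a, x, v), (b, y, w)] (allen_clause R a b)])"
  using assms by (cases R; auto simp: clause_tokens_def clause_terms_def Eq_def)+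

end

(* A clause that some valuation of the terms satisfies has a consistent closure: t < u and u \<le> t are
   never both derived.  Hence, whenever all four endpoints occur, a non-derivability needed for (non-)
   eagerness follows from a derivable strict atom in the opposite direction.  In the remaining clauses
   (before, meets and their inverses) only one endpoint of each token occurs, so the premises of the
   three eagerness conditions mention a term that the closure does not contain. *)

theory Submission
  imports Defs
begin

fun holds :: "('n tm \<Rightarrow> nat) \<Rightarrow> 'n atom \<Rightarrow> bool" where
  "holds f (t \<preceq> u) \<longleftrightarrow> f t \<le> f u"
| "holds f (t \<prec> u) \<longleftrightarrow> f t < f u"

text \<open>The second conjunct accounts for the closure rule \<open>start_end\<close>, whose atoms
  need not be entailed by the clause itself.\<close>

definition satisfiable :: "'n clause \<Rightarrow> bool" where
  "satisfiable C \<longleftrightarrow> (\<exists>f. (\<forall>\<alpha>\<in>C. holds f \<alpha>) \<and> (\<forall>a. f (Start a) < f (End a)))"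

text \<open>Every closure rule preserves truth under a valuation of the terms; only
  \<open>start_end\<close> needs the third assumption.\<close>

lemma atom_closure_sound:
  assumes "\<alpha> \<in> atom_closure C" and "\<And>\<beta>. \<beta> \<in> C \<Longrightarrow> holds f \<beta>"
    and "\<And>a. f (Start a) < f (End a)"
  shows "holds f \<alpha>"
  using assms(1) by induction (use assms(2,3) in auto)

lemma less_imp_not_ge:
  assumes "satisfiable C" and "(t \<prec> u) \<in> atom_closure C"
  shows "(u \<preceq> t) \<notin> atom_closure C"
proof
  assume "(u \<preceq> t) \<in> atom_closure C"
  moreover obtain f where "\<And>\<beta>. \<beta> \<in> C \<Longrightarrow> holds f \<beta>" "\<And>a. f (Start a) < f (End a)"
    using assms(1) by (auto simp: satisfiable_def)
  ultimately have "holds f (t \<prec> u)" "holds f (u \<preceq> t)"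
    using assms(2) atom_closure_sound by blast+
  then show False by simp
qed

text \<open>No rule brings in a new term: \<open>refl\<close> and \<open>start_end\<close> are
  guarded by occurrence in the clause. This refutes derivability when an endpoint is
  missing.\<close>

lemma atom_closure_terms:
  "\<alpha> \<in> atom_closure C \<Longrightarrow> atom_terms \<alpha> \<subseteq> clause_terms C"
  by (induction rule: atom_closure.induct) (auto simp: clause_terms_def)

lemma le_closure_terms:
  assumes "(t \<preceq> u) \<in> atom_closure C"
  shows "t \<in> clause_terms C \<and> u \<in> clause_terms C"
  using atom_closure_terms[OF assms] by auto

text \<open>The token \<open>a\<close> gets the interval from s to e, and every other token, not
  only \<open>b\<close>, gets the one from s' to e'. So four numbers also settle the requirement on
  all tokens.\<close>

lemma satisfiableI:
  assumes "a \<noteq> b" and "s < e" and "s' < e'"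
    and "\<forall>\<alpha>\<in>C. holds (\<lambda>t. case t of Start c \<Rightarrow> if c = a then s else s'
                                    | End c \<Rightarrow> if c = a then e else e') \<alpha>"
  shows "satisfiable C"
  unfolding satisfiable_def
  by (rule exI[of _ "\<lambda>t. case t of Start c \<Rightarrow> if c = a then s else s'
                                    | End c \<Rightarrow> if c = a then e else e'"]) (use assms in auto)

lemma satisfiable_allen:
  assumes "a \<noteq> b"
  shows "satisfiable (allen_clause R a b)"
proof (cases R)
  case Before
  \<comment> \<open>In each case the four numbers are the endpoints of \<open>a\<close> and then of
    \<open>b\<close>, for two concrete intervals that stand in the relation.\<close>
  then show ?thesis using assms by (intro satisfiableI[of a b 0 1 2 3]) auto
next
  case After
  then show ?thesis using assms by (intro satisfiableI[of a b 2 3 0 1]) auto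
next
  case Meets
  then show ?thesis using assms by (intro satisfiableI[of a b 0 1 1 2]) (auto simp: Eq_def)
next
  case MetBy
  then show ?thesis using assms by (intro satisfiableI[of a b 1 2 0 1]) (auto simp: Eq_def)
next
  case Ends
  then show ?thesis using assms by (intro satisfiableI[of a b 1 2 0 2]) (auto simp: Eq_def)
next
  case EndedBy
  then show ?thesis using assms by (intro satisfiableI[of a b 0 2 1 2]) (auto simp: Eq_def)
next
  case Starts
  then show ?thesis using assms by (intro satisfiableI[of a b 0 1 0 2]) (auto simp: Eq_def)
next
  case StartedBy
  then show ?thesis using assms by (intro satisfiableI[of a b 0 2 0 1]) (auto simp: Eq_def)
next
  case Overlaps
  then show ?thesis using assms by (intro satisfiableI[of a b 0 2 1 3]) auto
next
  case OverlappedBy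
  then show ?thesis using assms by (intro satisfiableI[of a b 1 3 0 2]) auto
next
  case During
  then show ?thesis using assms by (intro satisfiableI[of a b 1 2 0 3]) auto
next
  case Contains
  then show ?thesis using assms by (intro satisfiableI[of a b 0 3 1 2]) auto
next
  case Equals
  then show ?thesis using assms by (intro satisfiableI[of a b 0 1 0 1]) (auto simp: Eq_def)
qed

lemma clause_tokens_allen: "clause_tokens (allen_clause R a b) = {a, b}"
  by (cases R) (auto simp: clause_tokens_def clause_terms_def Eq_def)

lemma start_end_allen:
  assumes "R \<notin> {Before, After, Meets, MetBy}"
  shows "(Start a \<prec> End a) \<in> atom_closure (allen_clause R a b)"
  by (rule start_end) (use assms in \<open>cases R; auto simp: clause_terms_def Eq_def\<close>)+

text \<open>In each of the three conditions the premises mention both endpoints of the second token,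
  but the clause has only one endpoint of each token. All conditions are thus vacuous, whatever
  \<open>T\<close> is.\<close>

lemma eager_clause_end_start:
  assumes "a \<noteq> b" and terms: "clause_terms C = {End a, Start b}"
  shows "eager_clause T C"
proof -
  have tokens: "clause_tokens C = {a, b}"
    by (simp add: clause_tokens_def terms)
  have "(Start a \<preceq> t) \<notin> atom_closure C" "(t \<preceq> Start a) \<notin> atom_closure C"
    "(End b \<preceq> t) \<notin> atom_closure C" "(t \<preceq> End b) \<notin> atom_closure C" for t
    using le_closure_terms[of _ _ C] assms by auto
  then show ?thesis
    unfolding eager_clause_def tokens by simp
qed

lemma eager_clause_before_meets:
  assumes "a \<noteq> b" and "R \<in> {Before, After, Meets, MetBy}"
  shows "eager_clause T (allen_clause R a b)"
proof -
  have "clause_terms (allen_clause R a b) = {End a, Start b} \<or>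
      clause_terms (allen_clause R a b) = {End b, Start a}"
    using assms(2) by (auto simp: clause_terms_def Eq_def)
  then show ?thesis
    using eager_clause_end_start assms(1) by metis
qed

text \<open>With trigger \<open>a\<close> and one other token, the first condition lacks two
  non-trigger tokens, and the other two force \<open>b\<close> as the second token and
  \<open>a\<close> as the first. One instance of each remains.\<close>

lemma eager_clause_triggered_iff:
  assumes "a \<noteq> b"
  shows "eager_clause {a} (allen_clause R a b) \<longleftrightarrow>
    (let D = atom_closure (allen_clause R a b) in
      ((Start b \<preceq> Start a) \<in> D \<and> (Start a \<preceq> End b) \<in> D \<longrightarrow> (Start a \<preceq> Start b) \<in> D) \<and>
      ((Start a \<preceq> Start b) \<in> D \<and> (End a \<preceq> End b) \<in> D \<longrightarrow> (Start b \<preceq> Start a) \<in> D))"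
  using assms unfolding eager_clause_def clause_tokens_allen Let_def by auto

text \<open>Ends, overlapped-by and during violate the second eagerness condition; ended-by and
  overlaps violate the third.\<close>

lemma eager_clause_triggered_allen:
  assumes "a \<noteq> b"
  shows "eager_clause {a} (allen_clause R a b) \<longleftrightarrow>
    R \<notin> {Ends, EndedBy, Overlaps, OverlappedBy, During}"
proof (cases "R \<in> {Before, After, Meets, MetBy}")
  case True
  then show ?thesis using eager_clause_before_meets[OF assms] by auto
next
  case False
  define D where "D = atom_closure (allen_clause R a b)"
  have base: "\<alpha> \<in> D" if "\<alpha> \<in> allen_clause R a b" for \<alpha>
    using that by (simp add: D_def atom_closure.base)
  have le: "(t \<preceq> u) \<in> D" if "(t \<prec> u) \<in> D" for t u
    using that by (simp add: D_def less_imp_le)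
  have trans: "(t \<preceq> r) \<in> D" if "(t \<preceq> u) \<in> D" "(u \<preceq> r) \<in> D" for t u r
    using that unfolding D_def by (rule le_le_trans)
  have not_ge: "(u \<preceq> t) \<notin> D" if "(t \<prec> u) \<in> D" for t u
    using that less_imp_not_ge[OF satisfiable_allen[OF assms]] by (simp add: D_def)
  \<comment> \<open>For ends and during, the premise \<open>Start a \<preceq> End b\<close> is not
    in the clause; it comes from chaining this atom with one between the two ends.\<close>
  have se: "(Start a \<preceq> End a) \<in> D"
    unfolding D_def by (rule less_imp_le[OF start_end_allen[OF False]])
  note eager_iff = eager_clause_triggered_iff[OF assms, of R, folded D_def, unfolded Let_def]
  show ?thesis
  proof (cases R)
    case Ends
    then have "(Start b \<prec> Start a) \<in> D" "(End a \<preceq> End b) \<in> D"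
      by (auto intro: base simp: Eq_def)
    moreover from this(2) have "(Start a \<preceq> End b) \<in> D"
      using se trans by blast
    ultimately show ?thesis using Ends eager_iff not_ge le by auto
  next
    case EndedBy
    then have "(Start a \<prec> Start b) \<in> D" "(End a \<preceq> End b) \<in> D"
      by (auto intro: base simp: Eq_def)
    then show ?thesis using EndedBy eager_iff le not_ge by auto
  next
    case Overlaps
    then have "(Start a \<prec> Start b) \<in> D" "(End a \<prec> End b) \<in> D"
      by (auto intro: base)
    then show ?thesis using Overlaps eager_iff le not_ge by auto
  next
    case OverlappedBy
    then have "(Start b \<prec> Start a) \<in> D" "(Start a \<prec> End b) \<in> D"
      by (auto intro: base)
    then show ?thesis using OverlappedBy eager_iff le not_ge by auto
  next
    case During
    then have "(Start b \<prec> Start a) \<in> D" "(End a \<prec> End b) \<in> D"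
      by (auto intro: base)
    moreover from this(2) have "(Start a \<preceq> End b) \<in> D"
      using se trans le by blast
    ultimately show ?thesis using During eager_iff not_ge le by auto
  next
    \<comment> \<open>Each strict atom refutes a premise of one of the two conditions, so both are
      vacuous.\<close>
    case Contains
    then have "(Start a \<prec> Start b) \<in> D" "(End b \<prec> End a) \<in> D"
      by (auto intro: base)
    then show ?thesis using Contains eager_iff not_ge by auto
  next
    \<comment> \<open>Equal starts make the conclusions of both conditions derivable; the same
      happens in the next two cases.\<close>
    case Starts
    then have "(Start a \<preceq> Start b) \<in> D" "(Start b \<preceq> Start a) \<in> D"
      by (auto intro: base simp: Eq_def)
    then show ?thesis using Starts eager_iff by auto
  next
    case StartedBy
    then have "(Start a \<preceq> Start b) \<in> D" "(Start b \<preceq> Start a) \<in> D"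
      by (auto intro: base simp: Eq_def)
    then show ?thesis using StartedBy eager_iff by auto
  next
    case Equals
    then have "(Start a \<preceq> Start b) \<in> D" "(Start b \<preceq> Start a) \<in> D"
      by (auto intro: base simp: Eq_def)
    then show ?thesis using Equals eager_iff by auto
  qed (use False in auto)
qed

text \<open>The first eagerness condition fails with \<open>a\<close> as first and \<open>b\<close>
  as second token: \<open>b\<close> starts strictly before \<open>a\<close> ends, and
  \<open>a\<close> ends no later than \<open>b\<close>.\<close>

lemma not_eager_clause_triggerless:
  assumes "a \<noteq> b" and "R \<in> {Ends, Starts, Overlaps, During, Equals}"
  shows "\<not> eager_clause {} (allen_clause R a b)"
proof -
  define D where "D = atom_closure (allen_clause R a b)"
  have base: "\<alpha> \<in> D" if "\<alpha> \<in> allen_clause R a b" for \<alpha>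
    using that by (simp add: D_def atom_closure.base)
  have "(Start a \<prec> End a) \<in> D"
    using assms(2) start_end_allen[of R a b] by (auto simp: D_def)
  \<comment> \<open>The disjuncts cover ends and during, then starts and equals, then overlaps. The
    first two become strict bounds on \<open>End a\<close> through
    \<open>Start a \<prec> End a\<close>.\<close>
  moreover have "(Start b \<prec> Start a) \<in> D \<or> (Start b \<preceq> Start a) \<in> D \<or> (Start b \<prec> End a) \<in> D"
    using assms(2) base by (auto simp: Eq_def)
  ultimately have less: "(Start b \<prec> End a) \<in> D"
    unfolding D_def using le_less_trans less_imp_le by blast
  have "(End a \<preceq> End b) \<in> D \<or> (End a \<prec> End b) \<in> D"
    using assms(2) base by (auto simp: Eq_def)
  then have "(End a \<preceq> End b) \<in> D"
    unfolding D_def using less_imp_le by blast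
  moreover have "(Start b \<preceq> End a) \<in> D"
    using less unfolding D_def by (rule less_imp_le)
  moreover have "(End a \<preceq> Start b) \<notin> D"
    using less less_imp_not_ge[OF satisfiable_allen[OF assms(1)]] by (simp add: D_def)
  ultimately show ?thesis
    using assms(1) unfolding eager_clause_def clause_tokens_allen D_def by blast
qed

lemma eager_clause_triggerless_allen:
  assumes "a \<noteq> b"
  shows "eager_clause {} (allen_clause R a b) \<longleftrightarrow> R \<in> {Before, After, Meets, MetBy}"
proof (cases "R \<in> {Before, After, Meets, MetBy}")
  case True
  then show ?thesis using eager_clause_before_meets[OF assms] by blast
next
  case False
  \<comment> \<open>Without a trigger the two tokens play symmetric roles, so the inverse relations
    follow by exchanging the names.\<close>
  have inverse: "\<not> eager_clause {} (allen_clause S b a)" if "S \<in> {Ends, Starts, Overlaps, During}" for S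
    using that by (intro not_eager_clause_triggerless[OF assms[symmetric]]) blast
  have "\<not> eager_clause {} (allen_clause R a b)"
  proof (cases "R \<in> {Ends, Starts, Overlaps, During, Equals}")
    case True
    then show ?thesis by (rule not_eager_clause_triggerless[OF assms])
  next
    case inv: False
    show ?thesis
      using False inv inverse[of Ends] inverse[of Starts] inverse[of Overlaps] inverse[of During]
      by (cases R) (simp_all only: allen_clause.simps insert_iff empty_iff simp_thms)
  qed
  then show ?thesis using False by blast
qed

theorem mainTheorem2:
  fixes V :: "'x \<Rightarrow> 'v set" and a b :: 'n and x y :: 'x and v w :: 'v and R :: allen
  assumes "\<And>z. finite (V z)"
    and "a \<noteq> b"
    and "v \<in> V x"
    and "w \<in> V y"
  shows "(eager (Triggered (a, x, v) [Exists [(b, y, w)] (allen_clause R a b)]) \<longleftrightarrow>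
           R \<in> {Before, After, Meets, MetBy, Starts, StartedBy, Contains, Equals})
       \<and> (\<not> eager (Triggered (a, x, v) [Exists [(b, y, w)] (allen_clause R a b)]) \<longleftrightarrow>
           R \<in> {Ends, EndedBy, Overlaps, OverlappedBy, During})
       \<and> (eager (Triggerless [Exists [(a, x, v), (b, y, w)] (allen_clause R a b)]) \<longleftrightarrow>
           R \<in> {Before, After, Meets, MetBy})"
proof -
  let ?triggered = "Triggered (a, x, v) [Exists [(b, y, w)] (allen_clause R a b)]"
  let ?triggerless = "Triggerless [Exists [(a, x, v), (b, y, w)] (allen_clause R a b)]"
  have "eager ?triggered \<longleftrightarrow> R \<notin> {Ends, EndedBy, Overlaps, OverlappedBy, During}"
    using eager_clause_triggered_allen[OF assms(2)] by (simp add: eager_def)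
  moreover have "eager ?triggerless \<longleftrightarrow> R \<in> {Before, After, Meets, MetBy}"
    using eager_clause_triggerless_allen[OF assms(2)] by (simp add: eager_def)
  ultimately show ?thesis
    by (cases R) simp_all
qed

end
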